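(* Let $(A,\cdot,\ast)$ be a Novikov-Poisson algebra and let $\beta\colon A\to A$ be a morphism of Novikov-Poisson algebras. Define $x\cdot_\beta y=\beta(x\cdot y)$ and $x\ast_\beta y=\beta(x\ast y)$ for $x,y\in A$. Then $A_\beta=(A,\cdot_\beta,\ast_\beta,\beta)$ is a multiplicative Hom-Novikov-Poisson algebra.
   Context: Everything is over a fixed field $\mathbf{k}$ of characteristic $0$. A double Hom-algebra is a quadruple $(A,\cdot,\ast,\alpha)$ where $A$ is a $\mathbf{k}$-vector space, $\cdot$ and $\ast$ are bilinear operations $A\otimes A\to A$, and $\alpha\colon A\to A$ is a linear map (the twisting map). It is multiplicative if $\alpha(x\cdot y)=\alpha(x)\cdot\alpha(y)$ and $\alpha(x\ast y)=\alpha(x)\ast\alpha(y)$ for all $x,y$. A Hom-Novikov-Poisson algebra is a double Hom-algebra $(A,\cdot,\ast,\alpha)$ such that for all $x,y,z\in A$: (1) $(A,\cdot,\alpha)$ is a commutative Hom-associative algebra: $x\cdot y=y\cdot x$ and $(x\cdot y)\cdot\alpha(z)=\alpha(x)\cdot(y\cdot z)$; (2) $(A,\ast,\alpha)$ is a Hom-Novikov algebra: $(x\ast y)\ast\alpha(z)-\alpha(x)\ast(y\ast z)=(y\ast x)\ast\alpha(z)-\alpha(y)\ast(x\ast z)$ and $(x\ast y)\ast\alpha(z)=(x\ast z)\ast\alpha(y)$; (3) $(x\ast y)\cdot\alpha(z)-\alpha(x)\ast(y\cdot z)=(y\ast x)\cdot\alpha(z)-\alpha(y)\ast(x\cdot z)$;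 (4) $(x\cdot y)\ast\alpha(z)=(x\ast z)\cdot\alpha(y)$. A Novikov-Poisson algebra $(A,\cdot,\ast)$ is a Hom-Novikov-Poisson algebra with $\alpha=\mathrm{Id}_A$. A morphism $\beta\colon A\to A$ of Novikov-Poisson algebras is a linear map with $\beta(x\cdot y)=\beta(x)\cdot\beta(y)$ and $\beta(x\ast y)=\beta(x)\ast\beta(y)$ for all $x,y\in A$. *)

theory Defs
  imports Complex_Main
begin

text \<open>
  The vector space \<open>A\<close> is the whole type \<open>'a\<close>, with scalar multiplication \<open>scale\<close> over a field
  \<open>'k\<close> of characteristic 0. Since the library's \<open>bilinear\<close> is restricted to real vector spaces,
  bilinearity is stated as linearity in each argument.
\<close>

locale hom_algebra = vector_space scale
  for scale :: "'k::field_char_0 \<Rightarrow> 'a::ab_group_add \<Rightarrow> 'a" +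
  fixes mul :: "'a \<Rightarrow> 'a \<Rightarrow> 'a"
    and \<alpha> :: "'a \<Rightarrow> 'a"
  assumes linear_left: "Vector_Spaces.linear scale scale (\<lambda>x. mul x y)"
    and linear_right: "Vector_Spaces.linear scale scale (\<lambda>y. mul x y)"
    and linear_twist: "Vector_Spaces.linear scale scale \<alpha>"

locale comm_hom_associative_algebra = hom_algebra +
  assumes commute: "mul x y = mul y x"
    and hom_assoc: "mul (mul x y) (\<alpha> z) = mul (\<alpha> x) (mul y z)"

locale hom_novikov_algebra = hom_algebra +
  assumes hom_left_symmetric:
      "mul (mul x y) (\<alpha> z) - mul (\<alpha> x) (mul y z)
        = mul (mul y x) (\<alpha> z) - mul (\<alpha> y) (mul x z)"
    and hom_right_commute: "mul (mul x y) (\<alpha> z) = mul (mul x z) (\<alpha> y)"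

locale double_hom_algebra =
  dot: hom_algebra scale dot \<alpha> + ast: hom_algebra scale ast \<alpha>
  for scale :: "'k::field_char_0 \<Rightarrow> 'a::ab_group_add \<Rightarrow> 'a"
    and dot :: "'a \<Rightarrow> 'a \<Rightarrow> 'a"
    and ast :: "'a \<Rightarrow> 'a \<Rightarrow> 'a"
    and \<alpha> :: "'a \<Rightarrow> 'a"

locale multiplicative_double_hom_algebra = double_hom_algebra +
  assumes twist_dot: "\<alpha> (dot x y) = dot (\<alpha> x) (\<alpha> y)"
    and twist_ast: "\<alpha> (ast x y) = ast (\<alpha> x) (\<alpha> y)"

locale hom_novikov_poisson_algebra =
  double_hom_algebra scale dot ast \<alpha> +
  dot: comm_hom_associative_algebra scale dot \<alpha> +
  ast: hom_novikov_algebra scale ast \<alpha>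
  for scale :: "'k::field_char_0 \<Rightarrow> 'a::ab_group_add \<Rightarrow> 'a"
    and dot :: "'a \<Rightarrow> 'a \<Rightarrow> 'a"
    and ast :: "'a \<Rightarrow> 'a \<Rightarrow> 'a"
    and \<alpha> :: "'a \<Rightarrow> 'a" +
  assumes compat_left_symmetric:
      "dot (ast x y) (\<alpha> z) - ast (\<alpha> x) (dot y z)
        = dot (ast y x) (\<alpha> z) - ast (\<alpha> y) (dot x z)"
    and compat_right_commute: "ast (dot x y) (\<alpha> z) = dot (ast x z) (\<alpha> y)"

definition novikov_poisson_algebra ::
  "('k::field_char_0 \<Rightarrow> 'a::ab_group_add \<Rightarrow> 'a) \<Rightarrow> ('a \<Rightarrow> 'a \<Rightarrow> 'a) \<Rightarrow> ('a \<Rightarrow> 'a \<Rightarrow> 'a) \<Rightarrow> bool" where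
  "novikov_poisson_algebra scale dot ast \<longleftrightarrow> hom_novikov_poisson_algebra scale dot ast id"

definition novikov_poisson_morphism ::
  "('k::field_char_0 \<Rightarrow> 'a::ab_group_add \<Rightarrow> 'a) \<Rightarrow> ('a \<Rightarrow> 'a \<Rightarrow> 'a) \<Rightarrow> ('a \<Rightarrow> 'a \<Rightarrow> 'a) \<Rightarrow>
    ('a \<Rightarrow> 'a) \<Rightarrow> bool" where
  "novikov_poisson_morphism scale dot ast \<beta> \<longleftrightarrow>
    Vector_Spaces.linear scale scale \<beta> \<and>
    (\<forall>x y. \<beta> (dot x y) = dot (\<beta> x) (\<beta> y)) \<and>
    (\<forall>x y. \<beta> (ast x y) = ast (\<beta> x) (\<beta> y))"

end

theory Submission
  imports Defs
begin

text \<open>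
  This is Yau's twisting principle. Every axiom of a Novikov-Poisson algebra is an identity between
  linear combinations of products of exactly three factors, apart from commutativity and
  bilinearity. When both operations are replaced by
  their composites with the morphism \<open>\<beta>\<close> and the free factor is twisted by \<open>\<beta>\<close>, multiplicativity
  lets every occurrence of \<open>\<beta>\<close> be pulled to the outside, so each threefold product becomes \<open>\<beta>\<^sup>2\<close> of
  the original one. Each twisted axiom is therefore the image under the linear map \<open>\<beta>\<^sup>2\<close> of the
  untwisted axiom; commutativity, with only two factors, is the image under \<open>\<beta>\<close>. The principle is
  applied to each operation separately in \<open>comm_hom_associative_twist\<close> and \<open>hom_novikov_twist\<close>,
  and to the two compatibility axioms in the theorem itself.
\<close>

text \<open>
  Both left-symmetry axioms equate differences, and \<open>\<beta>\<close> reaches each term of such a difference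
  separately; this transports the equation one power of \<open>\<beta>\<close> at a time.
\<close>
lemma linear_diff_eq_diff:
  assumes "Vector_Spaces.linear s t f" and "a - b = c - d"
  shows "f a - f b = f c - f d"
proof -
  interpret Vector_Spaces.linear s t f by fact
  show ?thesis
    using assms(2) by (simp only: diff[symmetric])
qed

lemma hom_algebra_twist:
  assumes "hom_algebra scale mul \<alpha>"
    and "Vector_Spaces.linear scale scale \<beta>"
  shows "hom_algebra scale (\<lambda>x y. \<beta> (mul x y)) \<beta>"
proof -
  interpret hom_algebra scale mul \<alpha> by fact
  show ?thesis
  proof (intro hom_algebra.intro hom_algebra_axioms.intro)
    show "vector_space scale" ..
    show "Vector_Spaces.linear scale scale (\<lambda>x. \<beta> (mul x y))" for y
      using Vector_Spaces.linear_compose[OF linear_left[of y] assms(2)] by (simp only: comp_def)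
    show "Vector_Spaces.linear scale scale (\<lambda>y. \<beta> (mul x y))" for x
      using Vector_Spaces.linear_compose[OF linear_right[of x] assms(2)] by (simp only: comp_def)
    show "Vector_Spaces.linear scale scale \<beta>" by fact
  qed
qed

text \<open>
  Multiplicativity, read from right to left, collects the powers of \<open>\<beta>\<close> in front: both sides of
  Hom-associativity become \<open>\<beta>\<^sup>2\<close> of the two bracketings of \<open>x\<close>, \<open>y\<close>, \<open>z\<close>.
\<close>
lemma comm_hom_associative_twist:
  assumes "comm_hom_associative_algebra scale mul id"
    and lin: "Vector_Spaces.linear scale scale \<beta>"
    and mult: "\<And>x y. \<beta> (mul x y) = mul (\<beta> x) (\<beta> y)"
  shows "comm_hom_associative_algebra scale (\<lambda>x y. \<beta> (mul x y)) \<beta>"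
proof -
  interpret comm_hom_associative_algebra scale mul id by fact
  interpret tw: hom_algebra scale "\<lambda>x y. \<beta> (mul x y)" \<beta>
    by (rule hom_algebra_twist[OF hom_algebra_axioms lin])
  show ?thesis
  proof
    fix x y z
    show "\<beta> (mul x y) = \<beta> (mul y x)"
      by (simp only: commute[of x y])
    show "\<beta> (mul (\<beta> (mul x y)) (\<beta> z)) = \<beta> (mul (\<beta> x) (\<beta> (mul y z)))"
      unfolding mult[symmetric] using hom_assoc[of x y z] by simp
  qed
qed

lemma hom_novikov_twist:
  assumes "hom_novikov_algebra scale mul id"
    and lin: "Vector_Spaces.linear scale scale \<beta>"
    and mult: "\<And>x y. \<beta> (mul x y) = mul (\<beta> x) (\<beta> y)"
  shows "hom_novikov_algebra scale (\<lambda>x y. \<beta> (mul x y)) \<beta>"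
proof -
  interpret hom_novikov_algebra scale mul id by fact
  interpret tw: hom_algebra scale "\<lambda>x y. \<beta> (mul x y)" \<beta>
    by (rule hom_algebra_twist[OF hom_algebra_axioms lin])
  show ?thesis
  proof
    fix x y z
    show "\<beta> (mul (\<beta> (mul x y)) (\<beta> z)) - \<beta> (mul (\<beta> x) (\<beta> (mul y z)))
        = \<beta> (mul (\<beta> (mul y x)) (\<beta> z)) - \<beta> (mul (\<beta> y) (\<beta> (mul x z)))"
      unfolding mult[symmetric]
      by (intro linear_diff_eq_diff[OF lin]) (use hom_left_symmetric[of x y z] in simp)
    show "\<beta> (mul (\<beta> (mul x y)) (\<beta> z)) = \<beta> (mul (\<beta> (mul x z)) (\<beta> y))"
      unfolding mult[symmetric] using hom_right_commute[of x y z] by simp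
  qed
qed

theorem corollary2p15:
  fixes scale :: "'k::field_char_0 \<Rightarrow> 'a::ab_group_add \<Rightarrow> 'a"
    and dot ast :: "'a \<Rightarrow> 'a \<Rightarrow> 'a"
    and \<beta> :: "'a \<Rightarrow> 'a"
  assumes "novikov_poisson_algebra scale dot ast"
    and "novikov_poisson_morphism scale dot ast \<beta>"
  defines "dot\<^sub>\<beta> \<equiv> \<lambda>x y. \<beta> (dot x y)"
    and "ast\<^sub>\<beta> \<equiv> \<lambda>x y. \<beta> (ast x y)"
  shows "hom_novikov_poisson_algebra scale dot\<^sub>\<beta> ast\<^sub>\<beta> \<beta> \<and>
    multiplicative_double_hom_algebra scale dot\<^sub>\<beta> ast\<^sub>\<beta> \<beta>"
proof -
  interpret np: hom_novikov_poisson_algebra scale dot ast id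
    using assms(1) by (simp add: novikov_poisson_algebra_def)
  have lin: "Vector_Spaces.linear scale scale \<beta>"
    and dot: "\<beta> (dot x y) = dot (\<beta> x) (\<beta> y)"
    and ast: "\<beta> (ast x y) = ast (\<beta> x) (\<beta> y)" for x y
    using assms(2) by (auto simp: novikov_poisson_morphism_def)
  interpret d: comm_hom_associative_algebra scale dot\<^sub>\<beta> \<beta>
    unfolding dot\<^sub>\<beta>_def
    by (rule comm_hom_associative_twist[of scale dot \<beta>]) (fact np.dot.comm_hom_associative_algebra_axioms lin dot)+
  interpret a: hom_novikov_algebra scale ast\<^sub>\<beta> \<beta>
    unfolding ast\<^sub>\<beta>_def
    by (rule hom_novikov_twist[of scale ast \<beta>]) (fact np.ast.hom_novikov_algebra_axioms lin ast)+
  \<comment> \<open>The mixed products also collapse to \<open>\<beta>\<^sup>2\<close>, since \<open>\<beta>\<close> respects both operations.\<close>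
  have "hom_novikov_poisson_algebra scale dot\<^sub>\<beta> ast\<^sub>\<beta> \<beta>"
  proof
    fix x y z
    show "dot\<^sub>\<beta> (ast\<^sub>\<beta> x y) (\<beta> z) - ast\<^sub>\<beta> (\<beta> x) (dot\<^sub>\<beta> y z)
        = dot\<^sub>\<beta> (ast\<^sub>\<beta> y x) (\<beta> z) - ast\<^sub>\<beta> (\<beta> y) (dot\<^sub>\<beta> x z)"
      unfolding dot\<^sub>\<beta>_def ast\<^sub>\<beta>_def dot[symmetric] ast[symmetric]
      by (intro linear_diff_eq_diff[OF lin]) (use np.compat_left_symmetric[of x y z] in simp)
    show "ast\<^sub>\<beta> (dot\<^sub>\<beta> x y) (\<beta> z) = dot\<^sub>\<beta> (ast\<^sub>\<beta> x z) (\<beta> y)"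
      unfolding dot\<^sub>\<beta>_def ast\<^sub>\<beta>_def dot[symmetric] ast[symmetric]
      using np.compat_right_commute[of x y z] by simp
  qed
  moreover have "multiplicative_double_hom_algebra scale dot\<^sub>\<beta> ast\<^sub>\<beta> \<beta>"
    by unfold_locales (simp_all add: dot\<^sub>\<beta>_def ast\<^sub>\<beta>_def dot ast)
  ultimately show ?thesis ..
qed

end
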